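(* Let $n \geq 2203$ be an integer. Consider the following system $T$ of equations in the variables $x_1,\ldots,x_{n+11}$: \[ \begin{array}{rcl} x_i \cdot x_i & = & x_{i+1} \quad \text{for every } i \in \{1,\ldots,n\},\\ x_{n+2} + x_{n+2} & = & x_{n+3},\\ x_{n+3} + x_{n+3} & = & x_{n+4},\\ x_{n+4} + x_{n+2} & = & x_{n+5},\\ x_{n+6} & = & 1,\\ x_{n+5}+x_{n+6} & = & x_{n+7},\\ x_{n+7}+x_{n+6} & = & x_{n+8},\\ x_{n+8}+x_{n+6} & = & x_1,\\ x_{n+8} \cdot x_{n+8} & = & x_{n+9},\\ x_{n+9} \cdot x_{n+10} & = & x_{n+11},\\ x_{n+11}+x_1 & = & x_{2204}. \end{array} \] Then $T$ has a unique integer solution $(a_1,\ldots,a_{n+11}) \in \mathbb{Z}^{n+11}$. Moreover, the numbers $a_1,\ldots,a_{n+11}$ are positive and $\max(a_1,\ldots,a_{n+11}) > 2^{2^{n+11}}$.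
   Context: Since $n \geq 2203$, the index $2204$ lies in $\{1,\ldots,n+1\}$, so $x_{2204}$ is one of the variables $x_1,\ldots,x_{n+11}$. *)

theory Defs
  imports Complex_Main "HOL-Library.FuncSet"
begin

definition system_T :: "nat \<Rightarrow> (nat \<Rightarrow> int) \<Rightarrow> bool" where
  "system_T n x \<longleftrightarrow>
     (\<forall>i\<in>{1..n}. x i * x i = x (i + 1)) \<and>
     x (n + 2) + x (n + 2) = x (n + 3) \<and>
     x (n + 3) + x (n + 3) = x (n + 4) \<and>
     x (n + 4) + x (n + 2) = x (n + 5) \<and>
     x (n + 6) = 1 \<and>
     x (n + 5) + x (n + 6) = x (n + 7) \<and>
     x (n + 7) + x (n + 6) = x (n + 8) \<and>
     x (n + 8) + x (n + 6) = x 1 \<and>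
     x (n + 8) * x (n + 8) = x (n + 9) \<and>
     x (n + 9) * x (n + 10) = x (n + 11) \<and>
     x (n + 11) + x 1 = x 2204"

text \<open>
  Tuples in \<open>\<int>^(n + 11)\<close> are the functions that are extensional on the index set
  \<open>{1..n + 11}\<close>, so that equality of tuples is equality of functions.
\<close>

definition solutions_T :: "nat \<Rightarrow> (nat \<Rightarrow> int) set" where
  "solutions_T n = {a \<in> {1..n + 11} \<rightarrow>\<^sub>E UNIV. system_T n a}"

end

theory Submission
  imports Defs "HOL-Number_Theory.Residues"
begin

text \<open>
  Write \<open>y = x\<^sub>1\<close> and \<open>m = x\<^bsub>n+8\<^esub> = y - 1\<close>. The linear equations give \<open>m \<equiv> 2 (mod 5)\<close>, and the last
  three give \<open>m\<^sup>2 x\<^bsub>n+10\<^esub> = y^(2^2203) - y\<close>. Expanding \<open>(1 + m)^(2^2203)\<close> modulo \<open>m\<^sup>2\<close> shows that \<open>m\<close>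
  divides \<open>N = 2^2203 - 1\<close>. As \<open>N\<close> is prime and \<open>N \<equiv> 2 (mod 5)\<close>, only \<open>m = N\<close> is possible, that is
  \<open>x\<^sub>1 = 2^2203\<close>; this determines all other variables, and \<open>x\<^bsub>n+1\<^esub> = 2^(2203 * 2^n)\<close>.

  Primality of \<open>N\<close> is proved with a shortened Lucas-Lehmer test. If \<open>733\<close> iterations of
  \<open>s \<mapsto> s\<^sup>2 - 2\<close> carry some \<open>v\<close> to \<open>0\<close> modulo \<open>N\<close>, then every divisor of \<open>N\<close> is \<open>\<plusminus>1\<close> modulo \<open>2^735\<close>, and
  since \<open>3 * 735 > 2203\<close> this leaves no room for a proper divisor. A suitable \<open>v\<close> is the term with
  index \<open>1468\<close> of the classical sequence \<open>4, 14, 194, \<dots>\<close> modulo \<open>N\<close>; it is written down explicitly,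
  so that only a third of the \<open>2201\<close> squarings of the classical test has to be carried out.
\<close>

section \<open>Lucas sequences and Mersenne primes\<close>

text \<open>If \<open>v = x + 1/x\<close>, the terms are \<open>x^k + x^(-k)\<close>; the identities
  below are the familiar ones for such sums.\<close>

fun lucas_nat :: "int \<Rightarrow> nat \<Rightarrow> int" where
  "lucas_nat v 0 = 2"
| "lucas_nat v (Suc 0) = v"
| "lucas_nat v (Suc (Suc n)) = v * lucas_nat v (Suc n) - lucas_nat v n"

text \<open>The even extension to negative indices lets differences of indices occur without side
  conditions.\<close>

definition lucas :: "int \<Rightarrow> int \<Rightarrow> int" where
  "lucas v k = lucas_nat v (nat \<bar>k\<bar>)"

lemma lucas_0 [simp]: "lucas v 0 = 2"
  and lucas_1 [simp]: "lucas v 1 = v"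
  and lucas_minus [simp]: "lucas v (- k) = lucas v k"
  by (simp_all add: lucas_def)

lemma lucas_rec: "lucas v (k + 1) + lucas v (k - 1) = v * lucas v k"
proof -
  have *: "lucas v (k + 1) + lucas v (k - 1) = v * lucas v k" if "k \<ge> 1" for k
  proof -
    define n where "n = nat (k - 1)"
    have "nat \<bar>k + 1\<bar> = Suc (Suc n)" "nat \<bar>k - 1\<bar> = n" "nat \<bar>k\<bar> = Suc n"
      using that unfolding n_def by linarith+
    then show ?thesis by (simp add: lucas_def)
  qed
  consider "k \<ge> 1" | "k = 0" | "k \<le> -1" by linarith
  then show ?thesis
  proof cases
    case 3
    have "lucas v (- k + 1) + lucas v (- k - 1) = v * lucas v (- k)"
      using 3 by (intro *) simp
    moreover have "lucas v (- k + 1) = lucas v (k - 1)" "lucas v (- k - 1) = lucas v (k + 1)"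
      using lucas_minus[of v "k - 1"] lucas_minus[of v "k + 1"] by simp_all
    ultimately show ?thesis by simp
  next
    case 2
    then show ?thesis using lucas_minus[of v 1] by simp
  qed (use * in blast)
qed

text \<open>For \<open>v = x + 1/x\<close> this is \<open>(x^a + x^(-a)) * (x^b + x^(-b))\<close>
  multiplied out. The induction covers \<open>b\<close> nonnegative; evenness in the index gives the
  rest.\<close>

lemma lucas_mult: "lucas v a * lucas v b = lucas v (a + b) + lucas v (a - b)"
proof -
  have *: "lucas v a * lucas v (int n) = lucas v (a + int n) + lucas v (a - int n)" for n
  proof (induction n rule: induct_nat_012)
    case 1
    show ?case using lucas_rec[of v a] by (simp add: mult.commute)
  next
    case (ge2 n)
    have "lucas v (int (Suc (Suc n))) = v * lucas v (int (Suc n)) - lucas v (int n)"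
      using lucas_rec[of v "int (Suc n)"] by (simp add: algebra_simps)
    then have "lucas v a * lucas v (int (Suc (Suc n))) =
        v * (lucas v a * lucas v (int (Suc n))) - lucas v a * lucas v (int n)"
      by (simp only: right_diff_distrib mult.left_commute)
    also have "\<dots> = v * lucas v (a + int (Suc n)) + v * lucas v (a - int (Suc n))
        - lucas v (a + int n) - lucas v (a - int n)"
      unfolding ge2 by (simp add: algebra_simps)
    also have "\<dots> = lucas v (a + int (Suc (Suc n))) + lucas v (a - int (Suc (Suc n)))"
      using lucas_rec[of v "a + int (Suc n)"] lucas_rec[of v "a - int (Suc n)"]
      by (simp add: algebra_simps)
    finally show ?case .
  qed simp
  show ?thesis
  proof (cases "b \<ge> 0")
    case True
    then show ?thesis using *[of "nat b"] by simp
  next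
    case False
    then show ?thesis using *[of "nat (- b)"] by (simp add: add.commute)
  qed
qed

lemma lucas_double: "lucas v (2 * k) = (lucas v k)\<^sup>2 - 2"
  using lucas_mult[of v k k] by (simp add: power2_eq_square)

text \<open>Doubling the index is the Lucas-Lehmer map, so each iterate is a single term whose index
  is a power of two.\<close>

lemma lucas_pow2: "lucas v (2 ^ k) = ((\<lambda>s. s\<^sup>2 - 2) ^^ k) v"
  by (induction k) (simp_all add: lucas_double)

text \<open>Passing from \<open>x\<close> to \<open>x^n\<close> in \<open>x + 1/x\<close> composes
  the sequences, as for Chebyshev polynomials.\<close>

lemma lucas_lucas: "lucas v (int m * n) = lucas (lucas v n) (int m)"
proof (induction m rule: induct_nat_012)
  case (ge2 m)
  have "lucas v (int (Suc (Suc m)) * n) = lucas v n * lucas v (int (Suc m) * n) - lucas v (int m * n)"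
    using lucas_mult[of v "int (Suc m) * n" n] by (simp add: algebra_simps)
  also have "\<dots> = lucas (lucas v n) (int (Suc (Suc m)))"
    unfolding ge2 using lucas_rec[of "lucas v n" "int (Suc m)"] by (simp add: algebra_simps)
  finally show ?case .
qed simp_all

lemma lucas_of_minus_two: "lucas (- 2) (int m) = 2 * (- 1) ^ m"
proof (induction m rule: induct_nat_012)
  case (ge2 m)
  then show ?case
    using lucas_rec[of "- 2" "int (Suc m)"] by (simp add: algebra_simps)
qed simp_all

text \<open>This is the binomial expansion of \<open>(x + 1/x)^n\<close> added to its mirror image
  under \<open>x -> 1/x\<close>, hence the factor 2.\<close>

lemma power_eq_sum_lucas: "2 * v ^ n = (\<Sum>i\<le>n. int (n choose i) * lucas v (int n - 2 * int i))"
proof (induction n)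
  case (Suc n)
  let ?L = "\<lambda>i. lucas v (int (Suc n) - 2 * int i)"
  have "2 * v ^ Suc n = (\<Sum>i\<le>n. int (n choose i) * (v * lucas v (int n - 2 * int i)))"
    using Suc by (simp add: sum_distrib_left mult.left_commute)
  also have "\<dots> = (\<Sum>i\<le>n. int (n choose i) * (?L i + ?L (Suc i)))"
    by (intro sum.cong refl arg_cong2[where f = "(*)"]) (simp add: lucas_rec[symmetric] algebra_simps)
  also have "\<dots> = (\<Sum>i\<le>n. int (n choose i) * ?L i) + (\<Sum>i\<le>n. int (n choose i) * ?L (Suc i))"
    by (simp add: distrib_left sum.distrib)
  also have "(\<Sum>i\<le>n. int (n choose i) * ?L i) = (\<Sum>i\<le>Suc n. int (n choose i) * ?L i)"
    by simp
  also have "\<dots> = ?L 0 + (\<Sum>i\<le>n. int (n choose Suc i) * ?L (Suc i))"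
    by (subst sum.atMost_Suc_shift) simp
  also have "?L 0 + (\<Sum>i\<le>n. int (n choose Suc i) * ?L (Suc i)) + (\<Sum>i\<le>n. int (n choose i) * ?L (Suc i))
      = (\<Sum>i\<le>Suc n. int (Suc n choose i) * ?L i)"
    by (subst sum.atMost_Suc_shift) (simp add: sum.distrib[symmetric] algebra_simps)
  finally show ?case .
qed simp

section \<open>Lucas sequences modulo a prime\<close>

lemma fermat_int:
  fixes v :: int
  assumes "prime q"
  shows "[v ^ q = v] (mod int q)"
proof -
  have q: "q > 0" using assms prime_gt_0_nat by blast
  define w where "w = nat (v mod int q)"
  have "[w ^ q = w] (mod q)"
  proof (cases "q dvd w")
    case True
    moreover from this have "q dvd w ^ q" using q by (cases q) auto
    ultimately show ?thesis by (simp add: cong_def)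
  next
    case False
    have "[w ^ (q - 1) * w = 1 * w] (mod q)"
      by (intro cong_mult cong_refl fermat_theorem assms False)
    then show ?thesis using q by (simp add: power_eq_if mult.commute)
  qed
  then have "[int w ^ q = int w] (mod int q)"
    by (metis cong_int_iff of_nat_power)
  moreover have "[int w = v] (mod int q)"
    using q by (simp add: w_def cong_def)
  ultimately show ?thesis
    by (meson cong_pow cong_sym cong_trans)
qed

text \<open>In the binomial expansion the inner coefficients are divisible by \<open>q\<close>, the
  two outer terms agree, and the factor 2 cancels because \<open>q\<close> is odd. Fermat's theorem
  then replaces \<open>v ^ q\<close> by \<open>v\<close>.\<close>

lemma lucas_prime_index:
  assumes "prime q" "odd q"
  shows "[lucas v (int q) = v] (mod int q)"
proof -
  have q: "q > 0" using assms(1) prime_gt_0_nat by blast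
  have "[(\<Sum>i\<in>{1..<q}. int (q choose i) * lucas v (int q - 2 * int i)) = 0] (mod int q)"
    unfolding cong_0_iff using assms(1)
    by (intro dvd_sum dvd_mult2) (auto simp: int_dvd_int_iff intro!: dvd_choose_prime)
  moreover have "2 * v ^ q = 2 * lucas v (int q) + (\<Sum>i\<in>{1..<q}. int (q choose i) * lucas v (int q - 2 * int i))"
  proof -
    have "{..q} = insert 0 (insert q {1..<q})" using q by auto
    then have "2 * v ^ q = lucas v (int q) + (lucas v (- int q) + (\<Sum>i\<in>{1..<q}. int (q choose i) * lucas v (int q - 2 * int i)))"
      using q by (simp add: power_eq_sum_lucas)
    then show ?thesis by simp
  qed
  ultimately have "[2 * v ^ q = 2 * lucas v (int q)] (mod int q)"
    by (simp only: cong_iff_dvd_diff diff_0_right add_diff_cancel_left')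
  moreover have "coprime (2 :: int) (int q)"
    using assms(2) by simp
  ultimately have "[v ^ q = lucas v (int q)] (mod int q)"
    by (simp add: cong_mult_lcancel)
  moreover have "[v ^ q = v] (mod int q)"
    by (rule fermat_int) fact
  ultimately show ?thesis
    by (metis cong_sym cong_trans)
qed

text \<open>Take \<open>x\<close> with \<open>v = x + 1/x\<close> in an extension of the field with
  \<open>q\<close> elements. The hypothesis gives \<open>x ^ (2 ^ (k + 1)) = -1\<close>, so
  \<open>x\<close> has order \<open>2 ^ (k + 2)\<close>, and this order divides \<open>q - 1\<close>
  or \<open>q + 1\<close>. The proof expresses this by Lucas terms alone.\<close>

lemma prime_cong_of_lucas:
  assumes q: "prime q" "odd q" and dvd: "int q dvd lucas v (2 ^ k)"
  shows "2 ^ (k + 2) dvd int q - 1 \<or> 2 ^ (k + 2) dvd int q + 1"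
proof -
  let ?q = "int q"
  have pq: "prime ?q" using q by simp
  have Vq: "[lucas v ?q = v] (mod ?q)"
    using lucas_prime_index[OF q] .
  define A B where "A = lucas v (?q + 1)" and "B = lucas v (?q - 1)"
  have sum: "[A + B = v\<^sup>2] (mod ?q)"
    using cong_mult[OF cong_refl[of v] Vq] by (simp add: A_def B_def lucas_rec power2_eq_square)
  have "A * B = lucas v (2 * ?q) + lucas v (2 * 1)"
    using lucas_mult[of v "?q + 1" "?q - 1"] by (simp add: A_def B_def)
  then have "A * B = (lucas v ?q)\<^sup>2 + v\<^sup>2 - 4"
    unfolding lucas_double by simp
  then have prod: "[A * B = 2 * v\<^sup>2 - 4] (mod ?q)"
    using cong_pow[OF Vq, of 2] unfolding cong_iff_dvd_diff by (simp add: algebra_simps)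
  \<comment> \<open>Modulo \<open>q\<close>, the sum and product of \<open>A\<close> and
    \<open>B\<close> are those of \<open>2\<close> and \<open>v\<^sup>2 - 2\<close>, so one of
    \<open>A\<close>, \<open>B\<close> is \<open>2\<close>.\<close>
  have "?q dvd (A - 2) * (B - 2)"
  proof -
    have "(A - 2) * (B - 2) = (A * B - (2 * v\<^sup>2 - 4)) - 2 * (A + B - v\<^sup>2)"
      by (simp add: algebra_simps)
    then show ?thesis
      using sum prod unfolding cong_iff_dvd_diff by (simp only: dvd_diff dvd_mult)
  qed
  then have "?q dvd A - 2 \<or> ?q dvd B - 2"
    using pq prime_dvd_mult_iff by blast
  moreover have "2 ^ (k + 2) dvd int e" if "?q dvd lucas v (int e) - 2" "e > 0" for e
  proof (rule ccontr)
    assume no: "\<not> 2 ^ (k + 2) dvd int e"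
    obtain r where r: "e = 2 ^ multiplicity 2 e * r" "odd r"
      by (rule multiplicity_decompose'[of e 2]) (use \<open>e > 0\<close> in auto)
    define j where "j = multiplicity 2 e"
    have jr: "e = 2 ^ j * r" "odd r" unfolding j_def by fact+
    have "j < k + 2"
    proof (rule ccontr)
      assume "\<not> j < k + 2"
      then have "(2::int) ^ (k + 2) dvd 2 ^ j" by (intro le_imp_power_dvd) simp
      then show False using no jr by (simp add: dvd_mult2)
    qed
    \<comment> \<open>If the 2-part \<open>2 ^ j\<close> of \<open>e\<close> is too small, the index
      \<open>2 ^ i * e\<close> equals \<open>r * 2 ^ (k + 1)\<close>. Doubling the index keeps the
      value 2, whereas an odd multiple of \<open>2 ^ (k + 1)\<close> gives -2; hence
      \<open>q\<close> divides 4.\<close>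
    then obtain i where i: "k + 1 = j + i" using less_eqE[of j "k + 1"] by auto
    have two: "?q dvd lucas v (2 ^ i * int e) - 2" for i
    proof (induction i)
      case (Suc i)
      have "lucas v (2 ^ Suc i * int e) - 2 = (lucas v (2 ^ i * int e) - 2) * (lucas v (2 ^ i * int e) + 2)"
        using lucas_double[of v "2 ^ i * int e"] by (simp add: algebra_simps power2_eq_square)
      then show ?case using Suc by simp
    qed (use that in simp)
    have "[lucas v (2 ^ Suc k) = - 2] (mod ?q)"
      using dvd lucas_double[of v "2 ^ k"] by (simp add: cong_iff_dvd_diff power2_eq_square)
    then have m2: "?q dvd lucas v (2 ^ Suc k) + 2" by (simp add: cong_iff_dvd_diff)
    have cong_arg: "[lucas x (int m) = lucas y (int m)] (mod ?q)" if "[x = y] (mod ?q)" for x y m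
    proof (induction m rule: induct_nat_012)
      case (ge2 m)
      have "lucas z (int (Suc (Suc m))) = z * lucas z (int (Suc m)) - lucas z (int m)" for z
        using lucas_rec[of z "int (Suc m)"] by (simp add: algebra_simps)
      then show ?case using ge2 that by (simp add: cong_diff cong_mult)
    qed (use that in simp_all)
    have "2 ^ i * int e = int r * 2 ^ Suc k"
      using i jr by (simp add: power_add[symmetric] algebra_simps flip: power_Suc)
    then have "lucas v (2 ^ i * int e) = lucas (lucas v (2 ^ Suc k)) (int r)"
      by (simp only: lucas_lucas)
    moreover have "[lucas (lucas v (2 ^ Suc k)) (int r) = lucas (- 2) (int r)] (mod ?q)"
      by (rule cong_arg) fact
    moreover have "lucas (- 2) (int r) = - 2"
      using jr by (simp add: lucas_of_minus_two)
    ultimately have "?q dvd lucas v (2 ^ i * int e) + 2"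
      by (simp add: cong_iff_dvd_diff)
    from dvd_diff[OF this two[of i]] have "q dvd 2 ^ 2"
      using int_dvd_int_iff[of q 4] by simp
    then have "q dvd 2" using q prime_dvd_power by blast
    then have "q = 2" using q(1) primes_dvd_imp_eq two_is_prime_nat by blast
    then show False using q(2) by simp
  qed
  moreover have "int (q + 1) = ?q + 1" "int (q - 1) = ?q - 1" "q - 1 > 0"
    using prime_gt_1_nat[OF q(1)] by auto
  ultimately show ?thesis
    unfolding A_def B_def by (metis add_gr_0 zero_less_one)
qed

section \<open>Divisors of Mersenne numbers\<close>

lemma dvd_cong_pm_one:
  fixes M :: int and d N :: nat
  assumes "d dvd N" "N > 0"
    and primes: "\<And>q. prime q \<Longrightarrow> q dvd N \<Longrightarrow> M dvd int q - 1 \<or> M dvd int q + 1"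
  shows "M dvd int d - 1 \<or> M dvd int d + 1"
  using assms(1)
proof (induction d rule: less_induct)
  case (less d)
  show ?case
  proof (cases "d = 1")
    case False
    have "d > 0" using less.prems \<open>N > 0\<close> by (auto intro: Nat.gr0I)
    obtain q where q: "prime q" "q dvd d" using False prime_factor_nat by blast
    then obtain e where e: "d = q * e" by blast
    have "e < d" using e q \<open>d > 0\<close> prime_gt_1_nat[OF q(1)] by simp
    moreover have "e dvd N" using e less.prems by (metis dvd_mult_right)
    ultimately have "M dvd int e - 1 \<or> M dvd int e + 1" using less.IH by blast
    moreover have "M dvd int q - 1 \<or> M dvd int q + 1"
      using primes q less.prems dvd_trans by blast
    \<comment> \<open>The residues 1 and -1 are closed under multiplication; these are the four sign
      cases for \<open>d = q * e\<close>.\<close>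
    moreover have "int d - 1 = (int q - 1) * int e + (int e - 1)"
      "int d - 1 = (int q + 1) * int e - (int e + 1)"
      "int d + 1 = (int q - 1) * int e + (int e + 1)"
      "int d + 1 = (int q + 1) * int e - (int e - 1)"
      using e by (simp_all add: algebra_simps)
    ultimately show ?thesis
      by (metis dvd_add dvd_diff dvd_mult2)
  qed simp
qed

lemma square_neq_odd_power_of_two:
  fixes a :: int
  assumes "odd k"
  shows "a * a \<noteq> 2 ^ k"
proof
  assume eq: "a * a = 2 ^ k"
  then have "a \<noteq> 0" by auto
  have "k = multiplicity 2 (a * a)"
    unfolding eq by (simp add: multiplicity_same_power)
  also have "\<dots> = 2 * multiplicity 2 a"
    using \<open>a \<noteq> 0\<close> by (simp add: prime_elem_multiplicity_mult_distrib)
  finally show False using assms by simp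
qed

text \<open>With \<open>P = 2 ^ k\<close> and \<open>2 ^ n = P * P * R\<close>, where
  \<open>R < P\<close>, expanding the product yields \<open>b - a = P * c\<close> and
  \<open>R = a * b + c\<close> for some \<open>c\<close>. If \<open>c = 0\<close>, then
  \<open>R\<close> is a square but an odd power of two; if \<open>c\<close> is not 0, one of
  \<open>a\<close>, \<open>b\<close> is so large that \<open>R\<close> would be at least
  \<open>P\<close>.\<close>

lemma no_factors_pm_one:
  fixes a b :: int
  assumes "a \<ge> 1" "b \<ge> 1" and n: "odd n" "2 * k \<le> n" "n < 3 * k"
  shows "(a * 2 ^ k + 1) * (b * 2 ^ k - 1) \<noteq> 2 ^ n - 1"
proof
  assume eq: "(a * 2 ^ k + 1) * (b * 2 ^ k - 1) = 2 ^ n - 1"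
  define P :: int where "P = 2 ^ k"
  define R :: int where "R = 2 ^ (n - 2 * k)"
  have P: "P > 0" by (simp add: P_def)
  have RP: "R < P"
    unfolding P_def R_def using n by (intro power_strict_increasing) auto
  have "(2::int) ^ n = 2 ^ (k + k + (n - 2 * k))" using n by simp
  then have "2 ^ n = P * P * R" by (simp add: P_def R_def power_add)
  then have "P * (a * b * P + (b - a)) = P * (P * R)"
    using eq unfolding P_def[symmetric] by (simp add: algebra_simps)
  then have *: "a * b * P + (b - a) = P * R" using P by simp
  then have "b - a = P * (R - a * b)" by (simp add: algebra_simps)
  then obtain c where c: "b - a = P * c" "R = a * b + c" by (metis add.commute diff_add_cancel)
  consider "c = 0" | "c \<ge> 1" | "c \<le> -1" by linarith
  then show False
  proof cases
    case 1
    then have "a * a = 2 ^ (n - 2 * k)" using c by (simp add: R_def)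
    then show False using square_neq_odd_power_of_two[of "n - 2 * k" a] n by simp
  next
    case 2
    have "P * 1 \<le> P * c" using 2 P by (intro mult_left_mono) auto
    then have "P \<le> b" using c assms by linarith
    also have "b \<le> a * b" using assms by simp
    finally show False using c 2 RP by linarith
  next
    case 3
    have "a \<le> a * b" using assms by simp
    moreover have "(P - 1) * (- c) \<ge> (P - 1) * 1" using 3 P by (intro mult_left_mono) auto
    moreover from this have "P - 1 \<le> c - P * c" by (simp add: algebra_simps)
    ultimately show False using c assms RP by linarith
  qed
qed

text \<open>Every divisor is 1 or -1 modulo \<open>M\<close>. In a factorisation, equal signs
  contradict \<open>2 ^ n - 1\<close> being -1 modulo \<open>M\<close>, and opposite signs are
  excluded by \<open>no_factors_pm_one\<close>.\<close>

lemma mersenne_prime_if_lucas: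
  assumes n: "odd n" "2 * (k + 2) \<le> n" "n < 3 * (k + 2)"
    and dvd: "2 ^ n - 1 dvd lucas v (2 ^ k)"
  shows "prime (2 ^ n - 1 :: nat)"
proof -
  let ?N = "2 ^ n - 1 :: nat"
  define M :: int where "M = 2 ^ (k + 2)"
  have "n \<ge> 4" using n by simp
  then have "(2::nat) ^ 4 \<le> 2 ^ n" by (intro power_increasing) auto
  then have N: "?N > 1" by simp
  have intN: "int ?N = 2 ^ n - 1" by (simp add: of_nat_diff)
  have "M \<ge> 4" by (simp add: M_def)
  have primes: "M dvd int q - 1 \<or> M dvd int q + 1" if q: "prime q" "q dvd ?N" for q
    unfolding M_def
  proof (rule prime_cong_of_lucas)
    have "odd ?N" using \<open>n \<ge> 4\<close> by simp
    then show "odd q" using q(2) dvd_trans by blast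
    have "int q dvd int ?N" using q(2) by (simp only: int_dvd_int_iff)
    then show "int q dvd lucas v (2 ^ k)" using dvd intN by (metis dvd_trans)
  qed fact
  have "False" if de: "?N = d * e" "M dvd int d - 1" "M dvd int e + 1" "d > 1" for d e
  proof -
    obtain a b where a: "int d - 1 = M * a" and b: "int e + 1 = M * b"
      using de by (auto elim!: dvdE)
    have "M * a > 0" "M * b > 0" using a b de(4) by auto
    then have "a \<ge> 1" "b \<ge> 1" using \<open>M \<ge> 4\<close> by (auto simp: zero_less_mult_iff)
    moreover have "(a * M + 1) * (b * M - 1) = 2 ^ n - 1"
    proof -
      have "a * M + 1 = int d" "b * M - 1 = int e" using a b by (simp_all add: algebra_simps)
      then show ?thesis using intN de(1) by (metis of_nat_mult)
    qed
    ultimately show False using no_factors_pm_one n unfolding M_def by blast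
  qed
  note main = this
  have not_same: "\<not> (M dvd int d - s \<and> M dvd int e - s)" if "?N = d * e" "s * s = 1" for d e s
  proof
    assume *: "M dvd int d - s \<and> M dvd int e - s"
    have "int d * int e - 1 = (int d - s) * int e + s * (int e - s)"
      using that by (simp add: algebra_simps)
    then have "M dvd int d * int e - 1" using * by simp
    moreover have "int d * int e - 1 = 2 ^ n - 2"
      using intN that(1) by (metis diff_diff_eq of_nat_mult one_add_one)
    moreover have "M dvd 2 ^ n" unfolding M_def using n by (intro le_imp_power_dvd) simp
    ultimately have "M dvd 2 ^ n - (2 ^ n - 2)" by (metis dvd_diff)
    then show False using \<open>M \<ge> 4\<close> zdvd_imp_le[of M 2] by simp
  qed
  show ?thesis
  proof (rule prime_nat_iff[THEN iffD2], intro conjI allI impI)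
    fix d assume "d dvd ?N"
    then obtain e where e: "?N = d * e" by blast
    show "d = 1 \<or> d = ?N"
    proof (rule ccontr)
      assume no: "\<not> (d = 1 \<or> d = ?N)"
      have "d > 0" "e > 0" using e N by (auto intro: Nat.gr0I)
      then have "d > 1" "e > 1" using no e by (auto simp: nat_neq_iff less_Suc_eq)
      have pm: "M dvd int c - 1 \<or> M dvd int c + 1" if "c dvd ?N" for c
        by (rule dvd_cong_pm_one[OF that _ primes]) (use N in simp_all)
      have "d dvd ?N" "e dvd ?N" using e by simp_all
      note pm[OF this(1)] pm[OF this(2)]
      then show False
        using main[of d e] main[of e d] not_same[of d e 1] not_same[of d e "- 1"] e
          \<open>d > 1\<close> \<open>e > 1\<close> by (auto simp: mult.commute)
    qed
  qed (use N in simp)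
qed

section \<open>Arithmetic by rewriting\<close>

text \<open>
  Integers are written as strings of octal digits: \<open>D3 (D7 E)\<close> is \<open>3 + 8 * 7\<close>. Every digit and every
  state (multiplier and carry) of the multiply-accumulate automaton \<open>mac\<close> is a constant of its own,
  so that processing one digit is a single rewrite step by a table lookup. Addition is \<open>mac 1\<close>, and
  \<open>mac (-1)\<close> subtracts its first argument from the second. With multiplier \<open>m > 0\<close> the carry never
  exceeds \<open>m\<close>.
\<close>

definition dig :: "int \<Rightarrow> int \<Rightarrow> int" where
  "dig d x = 8 * x + d"

definition inc :: "int \<Rightarrow> int \<Rightarrow> int" where
  "inc c x = x + c"

definition mac :: "int \<Rightarrow> int \<Rightarrow> int \<Rightarrow> int \<Rightarrow> int" where
  "mac m c x y = m * x + y + c"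

definition E :: int where "E = 0"

definition D0 where "D0 = dig 0"
definition D1 where "D1 = dig 1"
definition D2 where "D2 = dig 2"
definition D3 where "D3 = dig 3"
definition D4 where "D4 = dig 4"
definition D5 where "D5 = dig 5"
definition D6 where "D6 = dig 6"
definition D7 where "D7 = dig 7"

definition J1 where "J1 = inc (-1)"
definition I0 where "I0 = inc 0"
definition I1 where "I1 = inc 1"
definition I2 where "I2 = inc 2"
definition I3 where "I3 = inc 3"
definition I4 where "I4 = inc 4"
definition I5 where "I5 = inc 5"
definition I6 where "I6 = inc 6"
definition I7 where "I7 = inc 7"
definition I8 where "I8 = inc 8"
definition I9 where "I9 = inc 9"
definition I10 where "I10 = inc 10"
definition I11 where "I11 = inc 11"
definition I12 where "I12 = inc 12"
definition I13 where "I13 = inc 13"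
definition I14 where "I14 = inc 14"

text \<open>\<open>S_1\<close> and \<open>S_0\<close> are the states of subtraction with and without
  a borrow. The multipliers 2 to 14 are the doubled digits that squaring requires; 4 also serves
  multiplication by 32.\<close>

definition S_1 where "S_1 = mac (-1) (-1)"
definition S_0 where "S_0 = mac (-1) 0"
definition M1_0 where "M1_0 = mac 1 0"
definition M1_1 where "M1_1 = mac 1 1"
definition M2_0 where "M2_0 = mac 2 0"
definition M2_1 where "M2_1 = mac 2 1"
definition M2_2 where "M2_2 = mac 2 2"
definition M4_0 where "M4_0 = mac 4 0"
definition M4_1 where "M4_1 = mac 4 1"
definition M4_2 where "M4_2 = mac 4 2"
definition M4_3 where "M4_3 = mac 4 3"
definition M4_4 where "M4_4 = mac 4 4"
definition M6_0 where "M6_0 = mac 6 0"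
definition M6_1 where "M6_1 = mac 6 1"
definition M6_2 where "M6_2 = mac 6 2"
definition M6_3 where "M6_3 = mac 6 3"
definition M6_4 where "M6_4 = mac 6 4"
definition M6_5 where "M6_5 = mac 6 5"
definition M6_6 where "M6_6 = mac 6 6"
definition M8_0 where "M8_0 = mac 8 0"
definition M8_1 where "M8_1 = mac 8 1"
definition M8_2 where "M8_2 = mac 8 2"
definition M8_3 where "M8_3 = mac 8 3"
definition M8_4 where "M8_4 = mac 8 4"
definition M8_5 where "M8_5 = mac 8 5"
definition M8_6 where "M8_6 = mac 8 6"
definition M8_7 where "M8_7 = mac 8 7"
definition M8_8 where "M8_8 = mac 8 8"
definition M10_0 where "M10_0 = mac 10 0"
definition M10_1 where "M10_1 = mac 10 1"
definition M10_2 where "M10_2 = mac 10 2"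
definition M10_3 where "M10_3 = mac 10 3"
definition M10_4 where "M10_4 = mac 10 4"
definition M10_5 where "M10_5 = mac 10 5"
definition M10_6 where "M10_6 = mac 10 6"
definition M10_7 where "M10_7 = mac 10 7"
definition M10_8 where "M10_8 = mac 10 8"
definition M10_9 where "M10_9 = mac 10 9"
definition M10_10 where "M10_10 = mac 10 10"
definition M12_0 where "M12_0 = mac 12 0"
definition M12_1 where "M12_1 = mac 12 1"
definition M12_2 where "M12_2 = mac 12 2"
definition M12_3 where "M12_3 = mac 12 3"
definition M12_4 where "M12_4 = mac 12 4"
definition M12_5 where "M12_5 = mac 12 5"
definition M12_6 where "M12_6 = mac 12 6"
definition M12_7 where "M12_7 = mac 12 7"
definition M12_8 where "M12_8 = mac 12 8"
definition M12_9 where "M12_9 = mac 12 9"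
definition M12_10 where "M12_10 = mac 12 10"
definition M12_11 where "M12_11 = mac 12 11"
definition M12_12 where "M12_12 = mac 12 12"
definition M14_0 where "M14_0 = mac 14 0"
definition M14_1 where "M14_1 = mac 14 1"
definition M14_2 where "M14_2 = mac 14 2"
definition M14_3 where "M14_3 = mac 14 3"
definition M14_4 where "M14_4 = mac 14 4"
definition M14_5 where "M14_5 = mac 14 5"
definition M14_6 where "M14_6 = mac 14 6"
definition M14_7 where "M14_7 = mac 14 7"
definition M14_8 where "M14_8 = mac 14 8"
definition M14_9 where "M14_9 = mac 14 9"
definition M14_10 where "M14_10 = mac 14 10"
definition M14_11 where "M14_11 = mac 14 11"
definition M14_12 where "M14_12 = mac 14 12"
definition M14_13 where "M14_13 = mac 14 13"
definition M14_14 where "M14_14 = mac 14 14"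

lemmas digit_defs = D0_def D1_def D2_def D3_def D4_def D5_def D6_def D7_def
lemmas inc_defs = J1_def I0_def I1_def I2_def I3_def I4_def I5_def I6_def I7_def I8_def I9_def
  I10_def I11_def I12_def I13_def I14_def
lemmas mac_defs = S_1_def S_0_def M1_0_def M1_1_def M2_0_def M2_1_def M2_2_def M4_0_def M4_1_def
  M4_2_def M4_3_def M4_4_def M6_0_def M6_1_def M6_2_def M6_3_def M6_4_def M6_5_def M6_6_def
  M8_0_def M8_1_def M8_2_def M8_3_def M8_4_def M8_5_def M8_6_def M8_7_def M8_8_def M10_0_def
  M10_1_def M10_2_def M10_3_def M10_4_def M10_5_def M10_6_def M10_7_def M10_8_def M10_9_def
  M10_10_def M12_0_def M12_1_def M12_2_def M12_3_def M12_4_def M12_5_def M12_6_def M12_7_def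
  M12_8_def M12_9_def M12_10_def M12_11_def M12_12_def M14_0_def M14_1_def M14_2_def M14_3_def
  M14_4_def M14_5_def M14_6_def M14_7_def M14_8_def M14_9_def M14_10_def M14_11_def M14_12_def
  M14_13_def M14_14_def

section \<open>Rewrite tables for the digit automaton\<close>

lemma mac_dig:
  "mac m c (dig a x) (dig b y) = dig ((m * a + b + c) mod 8) (mac m ((m * a + b + c) div 8) x y)"
proof -
  have "m * a + b + c = 8 * ((m * a + b + c) div 8) + (m * a + b + c) mod 8"
    by simp
  then show ?thesis
    unfolding mac_def dig_def by (simp add: algebra_simps)
qed

lemma mac_dig_E: "mac m c (dig a x) E = dig ((m * a + c) mod 8) (mac m ((m * a + c) div 8) x E)"
  using mac_dig[of m c a x 0 0] by (simp add: E_def dig_def)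

lemma inc_dig: "inc c (dig a x) = dig ((a + c) mod 8) (inc ((a + c) div 8) x)"
  using mac_dig[of 0 c 0 0 a x] by (simp add: inc_def mac_def)

text \<open>The bound \<open>c \<le> m\<close> selects the states that have a name; the next carry,
  at most \<open>(8 * m + 7) div 8\<close>, obeys it again. The bounded quantifiers are later
  unfolded into one rule per table entry.\<close>

lemma mac_add_instances:
  "\<forall>m\<in>{1,2,4,6,8,10,12,14}. \<forall>c\<in>{0,1,2,3,4,5,6,7,8,9,10,11,12,13,14}. c \<le> m \<longrightarrow>
     (\<forall>a\<in>{0,1,2,3,4,5,6,7}. \<forall>b\<in>{0,1,2,3,4,5,6,7}. \<forall>x y.
        mac m c (dig a x) (dig b y) =
        dig ((m * a + b + c) mod 8) (mac m ((m * a + b + c) div 8) x y))"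
  by (intro ballI allI impI) (rule mac_dig)

lemma mac_sub_instances:
  "\<forall>c\<in>{-1,0}. \<forall>a\<in>{0,1,2,3,4,5,6,7}. \<forall>b\<in>{0,1,2,3,4,5,6,7}. \<forall>x y.
     mac (-1) c (dig a x) (dig b y) =
     dig ((-1 * a + b + c) mod 8) (mac (-1) ((-1 * a + b + c) div 8) x y)"
  by (intro ballI allI) (rule mac_dig)

text \<open>These two multipliers can meet an exhausted second string, in Karatsuba's differences
  and in \<open>fold32\<close>. Multiplier 1 then reduces to \<open>inc\<close>, and squaring always
  adds to a string longer than the first.\<close>

lemma mac_dig_E_instances:
  "\<forall>c\<in>{-1,0}. \<forall>a\<in>{0,1,2,3,4,5,6,7}. \<forall>x.
     mac (-1) c (dig a x) E = dig ((-1 * a + c) mod 8) (mac (-1) ((-1 * a + c) div 8) x E)"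
  "\<forall>c\<in>{0,1,2,3,4}. \<forall>a\<in>{0,1,2,3,4,5,6,7}. \<forall>x.
     mac 4 c (dig a x) E = dig ((4 * a + c) mod 8) (mac 4 ((4 * a + c) div 8) x E)"
  by (intro ballI allI, rule mac_dig_E)+

lemma mac_E_instances:
  "\<forall>m\<in>{1,2,4,6,8,10,12,14}. \<forall>c\<in>{0,1,2,3,4,5,6,7,8,9,10,11,12,13,14}. c \<le> m \<longrightarrow>
     (\<forall>x. mac m c E x = inc c x)"
  "\<forall>c\<in>{-1,0}. \<forall>x. mac (-1) c E x = inc c x"
  "\<forall>c\<in>{0,1}. \<forall>x. mac 1 c x E = inc c x"
  by (auto simp: mac_def inc_def E_def)

lemma inc_dig_instances:
  "\<forall>c\<in>{-1,0,1,2,3,4,5,6,7,8,9,10,11,12,13,14}. \<forall>a\<in>{0,1,2,3,4,5,6,7}. \<forall>x.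
     inc c (dig a x) = dig ((a + c) mod 8) (inc ((a + c) div 8) x)"
  by (intro ballI allI) (rule inc_dig)

text \<open>The carry -1 is absent: \<open>inc (-1) E\<close> is negative and thus not a digit
  string.\<close>

lemma inc_E_instances:
  "\<forall>c\<in>{1,2,3,4,5,6,7}. inc c E = dig c E"
  "\<forall>c\<in>{8,9,10,11,12,13,14}. inc c E = dig (c - 8) (dig 1 E)"
  by (auto simp: inc_def E_def dig_def)

lemma I0_id: "I0 x = x"
  by (simp add: I0_def inc_def)

lemma ball_insert_iff: "(\<forall>x\<in>insert a A. P x) \<longleftrightarrow> P a \<and> (\<forall>x\<in>A. P x)" "(\<forall>x\<in>{}. P x) \<longleftrightarrow> True"
  by auto

text \<open>Folding the definitions back turns every evaluated instance into a rule between named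
  digits and states.\<close>

context
  notes digit_defs[symmetric, simp] inc_defs[symmetric, simp] mac_defs[symmetric, simp]
    conj_assoc[simp del]
begin

lemmas mac_add_table = mac_add_instances[unfolded ball_insert_iff, simplified]

lemmas mac_tables =
  mac_sub_instances[unfolded ball_insert_iff, simplified]
  mac_dig_E_instances[unfolded ball_insert_iff, simplified]
  mac_E_instances[unfolded ball_insert_iff, simplified]

lemmas inc_tables =
  inc_dig_instances[unfolded ball_insert_iff, simplified]
  inc_E_instances[unfolded ball_insert_iff, simplified]
  I0_id

end

lemma numeral_digits:
  "numeral (num.Bit0 (num.Bit0 (num.Bit0 w))) = D0 (numeral w)"
  "numeral (num.Bit1 (num.Bit0 (num.Bit0 w))) = D1 (numeral w)"
  "numeral (num.Bit0 (num.Bit1 (num.Bit0 w))) = D2 (numeral w)"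
  "numeral (num.Bit1 (num.Bit1 (num.Bit0 w))) = D3 (numeral w)"
  "numeral (num.Bit0 (num.Bit0 (num.Bit1 w))) = D4 (numeral w)"
  "numeral (num.Bit1 (num.Bit0 (num.Bit1 w))) = D5 (numeral w)"
  "numeral (num.Bit0 (num.Bit1 (num.Bit1 w))) = D6 (numeral w)"
  "numeral (num.Bit1 (num.Bit1 (num.Bit1 w))) = D7 (numeral w)"
  "numeral (num.Bit0 (num.Bit0 num.One)) = D4 E"
  "numeral (num.Bit1 (num.Bit0 num.One)) = D5 E"
  "numeral (num.Bit0 (num.Bit1 num.One)) = D6 E"
  "numeral (num.Bit1 (num.Bit1 num.One)) = D7 E"
  "numeral (num.Bit0 num.One) = D2 E"
  "numeral (num.Bit1 num.One) = D3 E"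
  "numeral num.One = D1 E"
  unfolding digit_defs dig_def E_def
  by (simp_all only: numeral.simps mult_zero_right mult_1_left distrib_right add_0_left add.assoc
      add.commute add.left_commute)

definition sqr :: "int \<Rightarrow> int" where
  "sqr x = x * x"

text \<open>From \<open>(8 * x + d)^2 = d^2 + 8 * (2 * d * x + 8 * x^2)\<close>: the multiplier is
  \<open>2 * d\<close> and the starting carry is \<open>d^2 div 8\<close>.\<close>

lemma sqr_digits:
  "sqr E = E"
  "sqr (D0 x) = D0 (D0 (sqr x))"
  "sqr (D1 x) = D1 (M2_0 x (D0 (sqr x)))"
  "sqr (D2 x) = D4 (M4_0 x (D0 (sqr x)))"
  "sqr (D3 x) = D1 (M6_1 x (D0 (sqr x)))"
  "sqr (D4 x) = D0 (M8_2 x (D0 (sqr x)))"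
  "sqr (D5 x) = D1 (M10_3 x (D0 (sqr x)))"
  "sqr (D6 x) = D4 (M12_4 x (D0 (sqr x)))"
  "sqr (D7 x) = D1 (M14_6 x (D0 (sqr x)))"
  by (simp_all add: sqr_def E_def digit_defs mac_defs mac_def dig_def algebra_simps)

definition fold32 :: "int \<Rightarrow> int \<Rightarrow> int" where
  "fold32 x y = x + 32 * y"

text \<open>Since \<open>32 = 8 * 4\<close>, the lowest digit stays and multiplier 4 acts one place
  higher.\<close>

lemma fold32_digits:
  "fold32 (D0 x) y = D0 (M4_0 y x)"
  "fold32 (D1 x) y = D1 (M4_0 y x)"
  "fold32 (D2 x) y = D2 (M4_0 y x)"
  "fold32 (D3 x) y = D3 (M4_0 y x)"
  "fold32 (D4 x) y = D4 (M4_0 y x)"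
  "fold32 (D5 x) y = D5 (M4_0 y x)"
  "fold32 (D6 x) y = D6 (M4_0 y x)"
  "fold32 (D7 x) y = D7 (M4_0 y x)"
  "fold32 E y = D0 (M4_0 y E)"
  by (simp_all add: fold32_def E_def digit_defs mac_defs mac_def dig_def)

definition lo :: "nat \<Rightarrow> int \<Rightarrow> int" where
  "lo k x = x mod 8 ^ k"

definition hi :: "nat \<Rightarrow> int \<Rightarrow> int" where
  "hi k x = x div 8 ^ k"

lemma lo_dig: "d \<in> {0..7} \<Longrightarrow> lo (Suc k) (dig d x) = dig d (lo k x)"
  by (simp add: lo_def dig_def zmod_zmult2_eq)

lemma hi_dig: "d \<in> {0..7} \<Longrightarrow> hi (Suc k) (dig d x) = hi k x"
  by (simp add: hi_def dig_def zdiv_zmult2_eq)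

lemma lo_digits:
  "lo (Suc k) (D0 x) = D0 (lo k x)"
  "lo (Suc k) (D1 x) = D1 (lo k x)"
  "lo (Suc k) (D2 x) = D2 (lo k x)"
  "lo (Suc k) (D3 x) = D3 (lo k x)"
  "lo (Suc k) (D4 x) = D4 (lo k x)"
  "lo (Suc k) (D5 x) = D5 (lo k x)"
  "lo (Suc k) (D6 x) = D6 (lo k x)"
  "lo (Suc k) (D7 x) = D7 (lo k x)"
  "lo 0 x = E"
  "lo k E = E"
  by (simp_all add: digit_defs lo_dig) (simp_all add: lo_def E_def)

lemma hi_digits:
  "hi (Suc k) (D0 x) = hi k x"
  "hi (Suc k) (D1 x) = hi k x"
  "hi (Suc k) (D2 x) = hi k x"
  "hi (Suc k) (D3 x) = hi k x"
  "hi (Suc k) (D4 x) = hi k x"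
  "hi (Suc k) (D5 x) = hi k x"
  "hi (Suc k) (D6 x) = hi k x"
  "hi (Suc k) (D7 x) = hi k x"
  "hi 0 x = x"
  "hi k E = E"
  by (simp_all add: digit_defs hi_dig) (simp_all add: hi_def E_def)

text \<open>
  Numbers modulo \<open>2^2203 - 1\<close> are polynomials in \<open>8^23\<close> with 32 coefficients, stored as the leaves of
  a perfect binary tree of depth 5. Coefficients may exceed \<open>8^23\<close> between two normalisations, so
  there are no carries inside the recursion of Karatsuba's squaring. As \<open>(8^23)^32 = 2^2208\<close> is
  congruent to 32, coefficients of degree at least 32 are folded back with weight 32.
\<close>

datatype coeffs = Leaf int | Node coeffs coeffs

fun perfect :: "nat \<Rightarrow> coeffs \<Rightarrow> bool" where
  "perfect 0 (Leaf x) \<longleftrightarrow> True"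
| "perfect (Suc j) (Node a b) \<longleftrightarrow> perfect j a \<and> perfect j b"
| "perfect _ _ \<longleftrightarrow> False"

fun val :: "nat \<Rightarrow> coeffs \<Rightarrow> int" where
  "val 0 (Leaf x) = x"
| "val (Suc j) (Node a b) = val j a + 8 ^ (23 * 2 ^ j) * val j b"
| "val _ _ = 0"

fun zipc :: "(int \<Rightarrow> int \<Rightarrow> int) \<Rightarrow> coeffs \<Rightarrow> coeffs \<Rightarrow> coeffs" where
  "zipc f (Leaf x) (Leaf y) = Leaf (f x y)"
| "zipc f (Node a b) (Node c d) = Node (zipc f a c) (zipc f b d)"
| "zipc f s t = s"

text \<open>The arguments are meant as the squares of \<open>a\<close>, \<open>a + b\<close> and
  \<open>b\<close>, each cut into two halves. Sums are formed first, so that each middle coefficient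
  takes a single subtraction (\<open>S_0\<close> subtracts its first argument).\<close>

fun karatsuba :: "coeffs \<Rightarrow> coeffs \<Rightarrow> coeffs \<Rightarrow> coeffs" where
  "karatsuba (Node p q) (Node r s) (Node u v) =
     Node (Node p (zipc S_0 (zipc M1_0 p u) (zipc M1_0 r q)))
          (Node (zipc S_0 (zipc M1_0 q v) (zipc M1_0 s u)) v)"
| "karatsuba a b c = a"

text \<open>The padding leaf \<open>E\<close> makes the result one level deeper than the argument,
  with room for twice as many coefficients.\<close>

fun square :: "nat \<Rightarrow> coeffs \<Rightarrow> coeffs" where
  "square 0 (Leaf x) = Node (Leaf (sqr x)) (Leaf E)"
| "square (Suc j) (Node a b) =
     karatsuba (square j a) (square j (zipc M1_0 a b)) (square j b)"
| "square _ t = t"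

fun split :: "nat \<Rightarrow> int \<Rightarrow> coeffs" and skip :: "nat \<Rightarrow> int \<Rightarrow> int" where
  "split 0 x = Leaf (lo 23 x)"
| "split (Suc j) x = Node (split j x) (split j (skip j x))"
| "skip 0 x = hi 23 x"
| "skip (Suc j) x = skip j (skip j x)"

fun overflow :: "coeffs \<Rightarrow> int" where
  "overflow (Leaf x) = hi 23 x"
| "overflow (Node a b) = overflow b"

text \<open>All excesses are read off the old leaves, as in a parallel carry. A leaf can therefore
  still exceed \<open>8^23\<close> afterwards, and \<open>step\<close> wraps twice.\<close>

fun carry :: "coeffs \<Rightarrow> int \<Rightarrow> coeffs" where
  "carry (Leaf x) c = Leaf (M1_0 (lo 23 x) c)"
| "carry (Node a b) c = Node (carry a c) (carry b (overflow a))"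

definition wrap :: "coeffs \<Rightarrow> coeffs" where
  "wrap t = carry t (fold32 E (overflow t))"

fun fold_halves :: "coeffs \<Rightarrow> coeffs" where
  "fold_halves (Node a b) = zipc fold32 a b"
| "fold_halves t = t"

text \<open>
  Congruent to \<open>-2\<close>, but with all coefficients nonnegative.
\<close>

definition neg_two :: int where
  "neg_two = 2 ^ 2208 - 34"

definition step :: "coeffs \<Rightarrow> coeffs" where
  "step t = wrap (wrap (zipc M1_0 (fold_halves (square 5 t)) (split 5 neg_two)))"

section \<open>Correctness of the modular squaring step\<close>

lemma zipc_linear:
  assumes "\<And>x y. f x y = u * x + w * y" "perfect j s" "perfect j t"
  shows "perfect j (zipc f s t) \<and> val j (zipc f s t) = u * val j s + w * val j t"
  using assms(2,3)
proof (induction j arbitrary: s t)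
  case 0
  then show ?case using assms(1) by (cases s; cases t) simp_all
next
  case (Suc j)
  then obtain a b c d where "s = Node a b" "t = Node c d" by (cases s; cases t) auto
  then show ?case using Suc by (simp add: algebra_simps)
qed

lemma M1_0_eq: "M1_0 x y = 1 * x + 1 * y"
  by (simp add: M1_0_def mac_def)

lemma S_0_eq: "S_0 x y = - 1 * x + 1 * y"
  by (simp add: S_0_def mac_def)

lemma fold32_eq: "fold32 x y = 1 * x + 32 * y"
  by (simp add: fold32_def)

lemmas zipc_add = zipc_linear[of M1_0, OF M1_0_eq]
lemmas zipc_sub = zipc_linear[of S_0, OF S_0_eq]
lemmas zipc_fold32 = zipc_linear[of fold32, OF fold32_eq]

lemma radix_Suc: "(8::int) ^ (23 * 2 ^ Suc j) = 8 ^ (23 * 2 ^ j) * 8 ^ (23 * 2 ^ j)"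
  by (simp add: power_add[symmetric] mult_2[symmetric] mult.left_commute)

lemma karatsuba_correct:
  assumes "perfect (Suc j) a" "perfect (Suc j) b" "perfect (Suc j) c"
  shows "perfect (Suc (Suc j)) (karatsuba a b c) \<and>
    val (Suc (Suc j)) (karatsuba a b c) =
      val (Suc j) a + 8 ^ (23 * 2 ^ j) * (val (Suc j) b - val (Suc j) a - val (Suc j) c)
      + 8 ^ (23 * 2 ^ Suc j) * val (Suc j) c"
proof -
  obtain p q r s u v where "a = Node p q" "b = Node r s" "c = Node u v"
    using assms by (cases a; cases b; cases c) auto
  then show ?thesis
    using assms unfolding radix_Suc
    by (simp add: zipc_add zipc_sub radix_Suc del: power_Suc) (simp add: algebra_simps)
qed

lemma square_correct:
  "perfect j t \<Longrightarrow> perfect (Suc j) (square j t) \<and> val (Suc j) (square j t) = (val j t)\<^sup>2"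
proof (induction j arbitrary: t)
  case 0
  then show ?case by (cases t) (simp_all add: sqr_def E_def power2_eq_square)
next
  case (Suc j)
  then obtain a b where t: "t = Node a b" "perfect j a" "perfect j b" by (cases t) auto
  then show ?case
    using Suc.IH[of a] Suc.IH[of b] Suc.IH[of "zipc M1_0 a b"]
    by (simp add: karatsuba_correct zipc_add radix_Suc power2_eq_square del: val.simps power_Suc)
       (simp add: algebra_simps)
qed

lemma skip_eq: "skip j x = x div 8 ^ (23 * 2 ^ j)"
  by (induction j arbitrary: x) (simp_all add: hi_def radix_Suc zdiv_zmult2_eq del: power_Suc)

lemma split_correct: "perfect j (split j x) \<and> val j (split j x) = x mod 8 ^ (23 * 2 ^ j)"
  by (induction j arbitrary: x)
     (simp_all add: lo_def skip_eq radix_Suc zmod_zmult2_eq add.commute del: power_Suc)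

lemma carry_correct:
  "perfect j t \<Longrightarrow> perfect j (carry t c) \<and>
     val j (carry t c) = val j t + c - 8 ^ (23 * 2 ^ j) * overflow t"
proof (induction j arbitrary: t c)
  case 0
  then show ?case
    by (cases t) (simp_all add: M1_0_eq lo_def hi_def minus_div_mult_eq_mod[symmetric] mult.commute)
next
  case (Suc j)
  then obtain a b where "t = Node a b" "perfect j a" "perfect j b" by (cases t) auto
  then show ?case
    using Suc.IH[of a] Suc.IH[of b]
    by (simp add: radix_Suc del: power_Suc) (simp add: algebra_simps)
qed

lemma radix_power_32: "(8::int) ^ (23 * 2 ^ 5) = 32 * 2 ^ 2203"
proof -
  have "(8::int) ^ (23 * 2 ^ 5) = (2 ^ 3) ^ 736" by simp
  also have "\<dots> = 2 ^ 5 * 2 ^ 2203" unfolding power_mult[symmetric] power_add[symmetric] by simp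
  finally show ?thesis by simp
qed

lemma wrap_correct:
  assumes "perfect 5 t"
  shows "perfect 5 (wrap t) \<and> [val 5 (wrap t) = val 5 t] (mod 2 ^ 2203 - 1)"
proof -
  have *: "perfect 5 (wrap t)"
    "val 5 (wrap t) = val 5 t + 32 * overflow t - 8 ^ (23 * 2 ^ 5) * overflow t"
    using carry_correct[OF assms, of "32 * overflow t"] by (simp_all add: wrap_def fold32_def E_def)
  have "val 5 (wrap t) - val 5 t = (2 ^ 2203 - 1) * (- 32 * overflow t)"
    unfolding * radix_power_32 by (simp only: algebra_simps)
  then show ?thesis using * by (simp only: cong_iff_dvd_diff dvd_triv_left)
qed

lemma perfect_SucE:
  assumes "perfect (Suc j) t"
  obtains a b where "t = Node a b" "perfect j a" "perfect j b"
  using assms by (cases t) auto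

lemma step_correct:
  assumes "perfect 5 t"
  shows "perfect 5 (step t) \<and> [val 5 (step t) = (val 5 t)\<^sup>2 - 2] (mod 2 ^ 2203 - 1)"
proof -
  let ?N = "2 ^ 2203 - 1 :: int"
  obtain a b where ab: "square 5 t = Node a b" "perfect 5 a" "perfect 5 b"
    using square_correct[OF assms] perfect_SucE by blast
  define s where "s = fold_halves (square 5 t)"
  have s: "perfect 5 s" "val 5 s = val 5 a + 32 * val 5 b"
    using zipc_fold32[OF ab(2,3)] by (simp_all add: s_def ab)
  have "(val 5 t)\<^sup>2 = val 5 a + 8 ^ (23 * 2 ^ 5) * val 5 b"
    using square_correct[OF assms] unfolding ab(1) val.simps by simp
  then have "val 5 s - (val 5 t)\<^sup>2 = ?N * (- 32 * val 5 b)"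
    unfolding s radix_power_32 by (simp only: algebra_simps)
  then have "[val 5 s = (val 5 t)\<^sup>2] (mod ?N)"
    by (simp only: cong_iff_dvd_diff dvd_triv_left)
  define z where "z = split 5 neg_two"
  have "(2::int) ^ 2208 = 32 * 2 ^ 2203"
    using power_add[of "2::int" 5 2203] by simp
  then have z: "perfect 5 z" "val 5 z = (32 * 2 ^ 2203 - 34) mod (32 * 2 ^ 2203)"
    using split_correct[of 5 neg_two] by (simp_all only: z_def neg_two_def radix_power_32)
  have "(2::int) ^ 1 \<le> 2 ^ 2203" by (intro power_increasing) simp_all
  \<comment> \<open>The variable \<open>A\<close> stands for \<open>2 ^ 2203\<close>, which is
    thereby not evaluated.\<close>
  moreover have "(32 * A - 34) mod (32 * A) = 32 * A - 34" if "2 ^ 1 \<le> A" for A :: int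
    using that by (intro mod_pos_pos_trivial) simp_all
  ultimately have "val 5 z = 32 * 2 ^ 2203 - 34" using z by metis
  \<comment> \<open>Indeed \<open>32 * 2 ^ 2203 - 34 = 32 * (2 ^ 2203 - 1) - 2\<close>.\<close>
  then have "val 5 z - (- 2) = ?N * 32" by (simp only: algebra_simps)
  then have "[val 5 z = - 2] (mod ?N)" by (simp only: cong_iff_dvd_diff dvd_triv_left)
  have sz: "perfect 5 (zipc M1_0 s z)" "val 5 (zipc M1_0 s z) = val 5 s + val 5 z"
    using zipc_add[OF s(1) z(1)] by simp_all
  have "step t = wrap (wrap (zipc M1_0 s z))"
    by (simp only: step_def s_def z_def)
  then have "perfect 5 (step t)" "[val 5 (step t) = val 5 s + val 5 z] (mod ?N)"
    using wrap_correct[OF sz(1)] wrap_correct[of "wrap (zipc M1_0 s z)"] sz(2)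
    by (auto intro: cong_trans)
  moreover have "[val 5 s + val 5 z = (val 5 t)\<^sup>2 + - 2] (mod ?N)"
    by (intro cong_add) fact+
  ultimately show ?thesis
    by (auto intro: cong_trans)
qed

lemma funpow_step_correct:
  assumes "perfect 5 t"
  shows "perfect 5 ((step ^^ k) t) \<and>
    [val 5 ((step ^^ k) t) = ((\<lambda>s. s\<^sup>2 - 2) ^^ k) (val 5 t)] (mod 2 ^ 2203 - 1)"
proof (induction k)
  case 0
  then show ?case using assms by simp
next
  case (Suc k)
  let ?t = "(step ^^ k) t" and ?v = "((\<lambda>s. s\<^sup>2 - 2) ^^ k) (val 5 t)"
  have "[(val 5 ?t)\<^sup>2 - 2 = ?v\<^sup>2 - 2] (mod 2 ^ 2203 - 1)"
    using Suc by (intro cong_diff cong_pow cong_refl) simp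
  then show ?case
    using step_correct[of ?t] Suc by (auto intro: cong_trans)
qed

section \<open>Primality of $2^{2203}-1$\<close>

text \<open>The recursive rules match on \<open>Suc\<close>, so the literals 23 and 5 are put into
  successor form.\<close>

lemma lo_23: "lo 23 x = lo (Suc (Suc (Suc (Suc (Suc (Suc (Suc (Suc (Suc (Suc (Suc (Suc (Suc (Suc (Suc (Suc (Suc (Suc (Suc (Suc (Suc (Suc (Suc 0))))))))))))))))))))))) x"
  by (simp only: numeral_eq_Suc pred_numeral_simps BitM.simps)

lemma hi_23: "hi 23 x = hi (Suc (Suc (Suc (Suc (Suc (Suc (Suc (Suc (Suc (Suc (Suc (Suc (Suc (Suc (Suc (Suc (Suc (Suc (Suc (Suc (Suc (Suc (Suc 0))))))))))))))))))))))) x"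
  by (simp only: numeral_eq_Suc pred_numeral_simps BitM.simps)

lemma square_5: "square 5 t = square (Suc (Suc (Suc (Suc (Suc 0))))) t"
  by (simp only: numeral_eq_Suc pred_numeral_simps BitM.simps)

lemma split_5: "split 5 x = split (Suc (Suc (Suc (Suc (Suc 0))))) x"
  by (simp only: numeral_eq_Suc pred_numeral_simps BitM.simps)

lemma neg_two_literal:
  "neg_two = 47231357286853767522716755927596215561986116650661432804728678927314249532098526380077034785580457260247952241007887375273000474840328294138062827690568625295902758435629765020876675007650887240298461920809005107679471980423130606355155258698193159389560724524486703687418766300787462745455454840419015572190253146649400636972799438629962334231348365404499947909495159747380366091782990708788254353238300987924815581261908398640232974138357658032571267179157147109522541069514133699125447168383688965455196623597661591747482353177871522320071696622482801372011199249874325447348286802406804399292729136049684688723519643837248433295481915701800013423925974328672222"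
  by (simp add: neg_two_def)

text \<open>Iteration follows the binary digits of the exponent, without unary numerals.\<close>

lemma funpow_numeral:
  "(f ^^ numeral (num.Bit0 k)) x = (f ^^ numeral k) ((f ^^ numeral k) x)"
  "(f ^^ numeral (num.Bit1 k)) x = (f ^^ numeral k) ((f ^^ numeral k) (f x))"
  "(f ^^ numeral num.One) x = f x"
  unfolding numeral_Bit0 numeral_Bit1 funpow_add o_apply by (simp_all add: numeral_One)

lemmas eval_rules =
  mac_add_table mac_tables inc_tables numeral_digits sqr_digits fold32_digits lo_digits hi_digits
  lo_23 hi_23 square_5 split_5 zipc.simps(1,2) karatsuba.simps(1) square.simps(1,2) split.simps
  skip.simps overflow.simps carry.simps wrap_def fold_halves.simps(1) step_def neg_two_literal
  funpow_numeral

text \<open>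
  Terms of the Lucas-Lehmer sequence \<open>4, 14, 194, \<dots>\<close>, about 46 steps apart, starting with the term of
  index 1468. They are normalised below \<open>2^2208\<close> rather than below \<open>2^2203 - 1\<close>: they are the values
  that \<open>step\<close> produces.
\<close>

definition cp0 :: int where
  "cp0 = 1291431165505383298407234881730332920607175186364789358203646326068321483947662838320299023271020811847323118413496942881414453409843823117058129337018999508756188365773094058394689009718492212217957826833272331881924468366631528088018217103896345834704118713066014453970041578025011040133504983519462099053032697602977753014397277425869809943479647157245628750926351574528610846083255398187114949170867634963215452375980398133397644302803081791432465877531351696654378473525110478239923577111483313813741483946882651398392322857847390272778649642555733961492035911897710437142982525124423882937423161713027170900058247186008305302437529477628569228763465185375062"
definition cp1 :: int where
  "cp1 = 10204496480218689879040033287291016897276542903013555313768469004726334329107743278130981633400290834103270860521882184143724485424938725041188764469174094630374159076677908097193042530005514088101676423523064857010697890691482075351687233948273242371758671143589325610674280697567747095404228524538567797241316718226254678000548629646552656731051419046466844339643997681879877876681657889383457580359012053065209376155651001787468458621899900047099143354872668145679612641473408534617579110004403157287130815090363488499107384985767479531457581065038343286385037740268849730000454235039086457278492069348931443574722895379915784592196007923165816912141075561519874"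
definition cp2 :: int where
  "cp2 = 42149375301568274251738262672877861387325065043564565241052677611802838572194291039349859733768677423411444915650154035971113719866743117383982386262658263554269675023131257830819452404078137870108738479537161677011622992772955726895497788468269637238864917563553430763935336197686103774957532353553654297482417832030156476603068811220548342238650491427708225955493221969593884321732025597568768282440133735106812290035124463894623985716137474670962334538054417885305201835708662333326487053385497912779826534965297237818301084109547773128197710113848625274857847062918343866708460883430844445965667149211399332701373587370020065658911340510767784633252109578711266"
definition cp3 :: int where
  "cp3 = 25099822848306424979440486696595461474888998251254343429430635873877834671207896567512861794459440210939674555642514096919076565962861559749026343546297364954410422235138621782425287062753465030883638493464251922943289025495790189853544308751160057608418274265916959790695161440779170754500060927182294363098264855218350273988880756173728104499772806632938861679359925538641141448587211261581561112848681168565220881005416217170268673359727503813149985046258414289483850817478770487746043704158150070325553000820714163554920866291478864634531661468808851655933602068329703497260423312551566958255981191697910567156984763698544636433906508012367845631840933127625186"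
definition cp4 :: int where
  "cp4 = 41643067096029063279461449446748746895112921214015230974414769103302513712020843410012195127709795202131497799905834326035323227806078475483722103424045703264926348223133181231452819747909229582384504462069799883211429031090447151415266599293568384645395716095453806309252611754246260326788819557334023391738558254667262316796536653913921687624637025815033914656507424594026249178167087973855138507679830948673231503240346435150389096839589460922262439781990525528881615150350259211134679960967685245310199405881437795094788529807258896531897407300700533707836033154387691763847917381990763597455821939431839965520928566178521896878970867576387515162047857607662306"
definition cp5 :: int where
  "cp5 = 43812305238428880545194694499093180044769959368028129486675092335998310286397672389911978582837546722214250955432476389942669625291712957935803920057496285536676240545116248912030706019418187808783919635627631607415170056232075007790498985673801504946369517686782839098463348471083938451936411631506925515012899698140666404776169051098935277359866617786061916505594252748606855824832961210326157965756044053457405176642676903657324898200756707107645637318964052819338500305808809593233534927343955641847451603083918993354065283998937398789660159911709578828061761335962541504857722173012830429860305362613859434656807277889708364020013052907214367391332425406182146"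
definition cp6 :: int where
  "cp6 = 12293589365746382074020039900289639880608410145532621707685065180926163333710926644640824105628654288728826347847393261144279695853174658686777352298149763631553676955606460880262305872750339916355995797504177903359092628565629171344582926362494239142754670893618990382192230650536446636879794437192968553470898233144293920478074860151460939887602912279634868500458312785637773213940058729221769217153429080383623281741605921959850295541208778164038211882987715483395838546508548074470307902777455016290465998903285220916021509575060905011179415022947884062947838394873209959824611803499630415333532484880473878911410654478368466304229299141533156239656761906136866"
definition cp7 :: int where
  "cp7 = 8723216768703369258428595037841896876433688743904890403915260896181637006681826194400666821145382449056164905733735350375710097878232030576671120398322905921730465691468105455646997885631013306246140610990224961025377184817530556232667332485296209545305206661129315093780572548115347407958487601572448988208884065774827720763336760173569839608250831019769435292740303374465531559240345895492541499881777507283240916196435991625275743775486714911182574394493688932901022334338003914817914046000581344039464409928129086586784837257160348928889583452187084896194284889288210596703900745522179222280213828134684204537913995960266516936359720500044964386999641409571906"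
definition cp8 :: int where
  "cp8 = 12223991186943002804620724217240942269201065860759910644436976858337175990655935600174467020061036863456773399792000495258812347167233644369860831775398774281583255130536224087504999799345147362996096505035723985264174397486436928593121622162207062862280765717022032533485336657230164268867229559338979502003562078911550337138328167541432695980606944478497933050090622063047300471767054411917119861667559770882669154421239357212676027912125819030608942847381235469115913460770862138523985272261095566073750192624142943923145163821595364717837455530873785657890549702580554454323485780140377929528882232787830942631521477962177626846347862090935487334622683001405826"
definition cp9 :: int where
  "cp9 = 28202380871169648307812237070867616186189285136722427501153844087282135542949350300505822297281902743360412180029735432906991841088924765788441438214464130716646690197015914293013259503447714052481417257116234023013345684390003098803699624519619618136111662336138631372105713440521950566476616791125656261854478528459569954556016635032497216501009125099112446209488887726517912472140032961191054281057003048808422540902963112279673355372342294200517607534935598325430371366516353125058260915566949324142913803736213201230050880606324050916660869315348236309902249869649909353503992113788683624565976405080665387489570570982894428642612215840420601562307154333775906"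
definition cp10 :: int where
  "cp10 = 15704229764828466713272729793892791163805065751540221408405764166657959166451634485033873732655741139000456779873963670635496750724782349073837105562742291438025586453872223245434560632869821996968484095152112324465011611000804497333073507934744239316879896416035352164679978360641738296729598732141252427358733876424373977454299898089799645572340079056246794449615730450824481622314538979296878765603383389834101030104600611676641937622287326567696116783335751685990450307150667107690300373185083042616125986402210913791462783731047167408504663726047965877213113264239723972102942382933753155619498296622355619888455042763642710498227262619802914034689104723661730"
definition cp11 :: int where
  "cp11 = 9176560695984562111174416174810277750490185894690706693153528751993706513456868673720553866739870613346620494450779398529853147373975556388838543389054899285564051674115141275992908682721890380707939565142871133140464536437303473129049914327130190609042817678745281796925314526669114689244627262897992732821776242314339238498399387179310778510137791223041494334065687939681867206474509499744959819774452232484034249271452768834169035618014897630068310723002515568465121220705620110065518550295446688197803940145863979806132427726409467835934685893489332705834038561653152324726538048461226668509704910784015518564052362336889033761065722338687107609843482822988578"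
definition cp12 :: int where
  "cp12 = 46470190638003319144302568058340749107485799698940255694351378307050719016745566202342869691777564568132259247098410968293154607577049394364746339958076785596026027217127944407899869775341663546254306795231720417530857732585350250799059161747645011539760329071853755296257717869489397410679226743415405621839501906858383711735733473914519954117076313771073472991390244527828447005614254114968702398085659353796899832996880990188739207367926895020563251466389751280627106496204558789371277188312994957150306518809791667669241296876746080034584220055578565109002644982269660522392520541517799601956774520227881793446312302941421513341223535401037552719528317226301474"
definition cp13 :: int where
  "cp13 = 15789164832076142596756346609641141692981896959031446016906029561044266666343524918183846073441467038323566620897246974170843387282110183484428407519933935138203655006290496072528137386000886249233640883106955498527536091250683293718390739443517975741008073909226073603680721995085792108454950284077303339129488238154817252028182657039209194939158558217550958521404287553859721487317688303696427837132525105175546685260204586115282649160052195011744025918481998727473663164243073600132347769063699278755208991365868522113557437388854698957861217187670580021795605472489733833919480314954303522639907282194830612747990315496653397767765075084571699524349190753258434"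
definition cp14 :: int where
  "cp14 = 41633229753849038356571598825465533067451265819131515714097669162701165178760477861183707306961633623781618994972664059437583720927006964460855212864251678119750081975962429554287448077675822053907552425948334739473626060907509504749196586830254789288985688810245558863966180997796442678973482114007525392695200391436613563905812999380580402885537151145115517590652419130184276292216094611324321861997957144308736510837073518038060262561167991428885887147588161182921462404104913629621929757962011137944463061182256166495869860483123158155541874227529533603077154533275023643532681722436246178183003709592048297111326175720168390836658219399779374290196868484124738"
definition cp15 :: int where
  "cp15 = 10218763027235605052525399201958669332831596638613323996076996184567563250989841863319805709260936553428387452789180697266609736914833829598898128237882175969222994248191653234251384784044075288628419217695447902240370830511631856354114078599922841717602426365976529586200277390759477619656157072371975367899704519084429104634580168370412286026072542104161962862488363695246195488242098674329361099586294852368409550613232723691986937338988978670344032856057844214979794245372563127918556175688158110179553617279916530470309212748720262573280681414950857937928371374405522964429876205302310906373943398055307802214055379534923940280481352345721384780225276584623970"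
definition cp16 :: int where
  "cp16 = 44279397456425407052546958682121452089361984359995093254433136494357108936342368481322220111481678681482455225944894414318437945162807775754433900959908086214908836033402904707071882819672706787779808050758442288449504981646684943457958055029556086927713179241706284706955093406988246323864488912892827098928362324983813097161999473715589688341889092566718701165151712263169093211046553789488988456160907176179514607433039123725218413254710304405535562980459825415177382252669500342930106720359708405114246834622807742263264706104254552175067215583577626286260499296757180106889018877256379124336933565046579395678299666097420406214514295970437512584930600933130210"

text \<open>The computation is cut into sixteen stretches of 46, 47 or 39 steps, 733 in all, each
  evaluated by rewriting.\<close>

lemma run0: "(step ^^ 46) (split 5 cp0) = split 5 cp1"
  by (simp only: eval_rules cp0_def cp1_def)

lemma run1: "(step ^^ 47) (split 5 cp1) = split 5 cp2"
  by (simp only: eval_rules cp1_def cp2_def)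

lemma run2: "(step ^^ 47) (split 5 cp2) = split 5 cp3"
  by (simp only: eval_rules cp2_def cp3_def)

lemma run3: "(step ^^ 47) (split 5 cp3) = split 5 cp4"
  by (simp only: eval_rules cp3_def cp4_def)

lemma run4: "(step ^^ 47) (split 5 cp4) = split 5 cp5"
  by (simp only: eval_rules cp4_def cp5_def)

lemma run5: "(step ^^ 46) (split 5 cp5) = split 5 cp6"
  by (simp only: eval_rules cp5_def cp6_def)

lemma run6: "(step ^^ 46) (split 5 cp6) = split 5 cp7"
  by (simp only: eval_rules cp6_def cp7_def)

lemma run7: "(step ^^ 46) (split 5 cp7) = split 5 cp8"
  by (simp only: eval_rules cp7_def cp8_def)

lemma run8: "(step ^^ 46) (split 5 cp8) = split 5 cp9"
  by (simp only: eval_rules cp8_def cp9_def)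

lemma run9: "(step ^^ 46) (split 5 cp9) = split 5 cp10"
  by (simp only: eval_rules cp9_def cp10_def)

lemma run10: "(step ^^ 46) (split 5 cp10) = split 5 cp11"
  by (simp only: eval_rules cp10_def cp11_def)

lemma run11: "(step ^^ 46) (split 5 cp11) = split 5 cp12"
  by (simp only: eval_rules cp11_def cp12_def)

lemma run12: "(step ^^ 46) (split 5 cp12) = split 5 cp13"
  by (simp only: eval_rules cp12_def cp13_def)

lemma run13: "(step ^^ 46) (split 5 cp13) = split 5 cp14"
  by (simp only: eval_rules cp13_def cp14_def)

lemma run14: "(step ^^ 46) (split 5 cp14) = split 5 cp15"
  by (simp only: eval_rules cp14_def cp15_def)

lemma run15: "(step ^^ 39) (split 5 cp15) = split 5 cp16"
  by (simp only: eval_rules cp15_def cp16_def)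

lemma run: "(step ^^ 733) (split 5 cp0) = split 5 cp16"
proof -
  \<comment> \<open>The rightmost summand is applied first, so the stretches appear in reverse
    order.\<close>
  have sum: "(733::nat) =
      39 + (46 + (46 + (46 + (46 + (46 + (46 +
      (46 + (46 + (46 + (46 + (47 + (47 + (47 + (47 + 46))))))))))))))"
    by simp
  show ?thesis
    unfolding sum funpow_add o_apply run0 run1 run2 run3 run4 run5 run6 run7 run8 run9 run10 run11
      run12 run13 run14 run15 ..
qed

lemma cp_bounds: "0 \<le> cp0" "cp0 < 8 ^ (23 * 2 ^ 5)" "0 \<le> cp16" "cp16 < 8 ^ (23 * 2 ^ 5)"
  by (simp_all add: cp0_def cp16_def)

text \<open>Values are reduced only below \<open>2 ^ 2208\<close>, so the final zero modulo
  \<open>2 ^ 2203 - 1\<close> shows up as a nonzero multiple.\<close>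

lemma cp16_dvd: "2 ^ 2203 - 1 dvd cp16"
proof -
  have "cp16 = (2 ^ 2203 - 1) * 30" by (simp add: cp16_def)
  then show ?thesis by (metis dvd_triv_left)
qed

lemma prime_mersenne_2203: "prime (2 ^ 2203 - 1 :: nat)"
proof (rule mersenne_prime_if_lucas[where k = 733 and v = cp0])
  \<comment> \<open>Both numbers lie below \<open>2 ^ 2208\<close>, so splitting into 32
    coefficients loses nothing.\<close>
  have "val 5 (split 5 cp0) = cp0" "val 5 (split 5 cp16) = cp16"
    using split_correct[of 5 cp0] split_correct[of 5 cp16] cp_bounds
    by (simp_all only: mod_pos_pos_trivial)
  then have "[cp16 = lucas cp0 (2 ^ 733)] (mod 2 ^ 2203 - 1)"
    using funpow_step_correct[of "split 5 cp0" 733] split_correct[of 5 cp0]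
    unfolding run lucas_pow2 by (simp only: simp_thms)
  then show "2 ^ 2203 - 1 dvd lucas cp0 (2 ^ 733)"
    using cp16_dvd cong_dvd_iff by blast
qed simp_all

section \<open>The system of equations\<close>

text \<open>The exponent 2203 becomes a variable \<open>p\<close>, so that no large power is
  evaluated in the arguments below.\<close>

definition mersenne_system :: "nat \<Rightarrow> nat \<Rightarrow> (nat \<Rightarrow> int) \<Rightarrow> bool" where
  "mersenne_system p n x \<longleftrightarrow>
     (\<forall>i\<in>{1..n}. x i * x i = x (i + 1)) \<and>
     x (n + 2) + x (n + 2) = x (n + 3) \<and>
     x (n + 3) + x (n + 3) = x (n + 4) \<and>
     x (n + 4) + x (n + 2) = x (n + 5) \<and>
     x (n + 6) = 1 \<and>
     x (n + 5) + x (n + 6) = x (n + 7) \<and>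
     x (n + 7) + x (n + 6) = x (n + 8) \<and>
     x (n + 8) + x (n + 6) = x 1 \<and>
     x (n + 8) * x (n + 8) = x (n + 9) \<and>
     x (n + 9) * x (n + 10) = x (n + 11) \<and>
     x (n + 11) + x 1 = x (p + 1)"

section \<open>The first variable is determined\<close>

lemma iterated_squares:
  fixes x :: "nat \<Rightarrow> 'a :: monoid_mult"
  assumes "\<forall>i\<in>{1..n}. x i * x i = x (i + 1)" "i \<le> n"
  shows "x (i + 1) = x 1 ^ (2 ^ i)"
  using assms(2)
proof (induction i)
  case (Suc i)
  then have "x (Suc i + 1) = x (i + 1) * x (i + 1)"
    using bspec[OF assms(1), of "Suc i"] Suc.prems by simp
  also have "\<dots> = x 1 ^ (2 ^ i + 2 ^ i)" using Suc by (simp add: power_add)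
  finally show ?case by (simp add: mult_2)
qed simp

text \<open>The binomial expansion to first order. It serves twice: to restrict \<open>m\<close> in
  any solution, and to show that the quotient in the explicit solution is exact.\<close>

lemma power_one_plus_dvd:
  fixes m :: int
  shows "m * m dvd (1 + m) ^ e - 1 - int e * m"
proof (induction e)
  case (Suc e)
  have "(1 + m) ^ Suc e - 1 - int (Suc e) * m =
      (1 + m) * ((1 + m) ^ e - 1 - int e * m) + m * m * int e"
    by (simp add: algebra_simps)
  then show ?case using Suc by simp
qed simp

lemma mersenne_system_first:
  assumes "p \<le> n" "prime (2 ^ p - 1 :: int)" "(2 ^ p - 1 :: int) mod 5 = 2"
    and sys: "mersenne_system p n x"
  shows "x 1 = 2 ^ p"
proof -
  define m where "m = x (n + 8)"
  have x1: "x 1 = 1 + m" and m5: "m = 5 * x (n + 2) + 2"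
    using sys by (auto simp: mersenne_system_def m_def)
  then have "m \<noteq> 0" "m mod 5 = 2" by presburger+
  have "x (p + 1) = (1 + m) ^ (2 ^ p)"
    using iterated_squares[of n x p] sys assms(1) x1 by (simp add: mersenne_system_def)
  then have "(1 + m) ^ (2 ^ p) = m * m * x (n + 10) + (1 + m)"
    using sys x1 by (simp add: mersenne_system_def m_def)
  then have "m * m dvd (m * m * x (n + 10) + (1 + m)) - 1 - int (2 ^ p) * m"
    using power_one_plus_dvd[of m "2 ^ p"] by simp
  moreover have "(m * m * x (n + 10) + (1 + m)) - 1 - int (2 ^ p) * m =
      m * m * x (n + 10) - m * (2 ^ p - 1)"
    by (simp add: algebra_simps)
  ultimately have "m * m dvd m * m * x (n + 10) - m * (2 ^ p - 1)" by (simp only:)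
  then have "m * m dvd m * (2 ^ p - 1)"
    by (metis dvd_triv_left dvd_diff diff_diff_eq2 add_diff_cancel_left')
  then have "m dvd 2 ^ p - 1" using \<open>m \<noteq> 0\<close> by simp
  then have "\<bar>m\<bar> = 1 \<or> \<bar>m\<bar> = 2 ^ p - 1"
    using assms(2) prime_int_iff[of "2 ^ p - 1"] abs_dvd_iff[of m] abs_ge_zero[of m] by blast
  \<comment> \<open>Modulo 5, the candidates 1, -1 and \<open>-(2 ^ p - 1)\<close> leave 1, 4 and 3
    instead of 2.\<close>
  then have "m = 2 ^ p - 1"
    using \<open>m mod 5 = 2\<close> assms(3) by presburger
  then show ?thesis using x1 by simp
qed

section \<open>The explicit solution\<close>

definition mersenne_solution :: "nat \<Rightarrow> nat \<Rightarrow> nat \<Rightarrow> int" where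
  "mersenne_solution p n i =
    (let y = 2 ^ p; t = (y - 3) div 5; m = y - 1; w = y ^ 2 ^ p - y in
     if i \<in> {1..n + 1} then y ^ 2 ^ (i - 1)
     else if i = n + 2 then t
     else if i = n + 3 then 2 * t
     else if i = n + 4 then 4 * t
     else if i = n + 5 then 5 * t
     else if i = n + 6 then 1
     else if i = n + 7 then 5 * t + 1
     else if i = n + 8 then m
     else if i = n + 9 then m * m
     else if i = n + 10 then w div (m * m)
     else if i = n + 11 then w
     else undefined)"

lemma atLeastAtMost_add_11:
  "{1..n + 11} = {1..n + 1} \<union> {n + 2, n + 3, n + 4, n + 5, n + 6, n + 7, n + 8, n + 9, n + 10, n + 11}"
  for n :: nat
  by auto presburger

text \<open>Makes the solution extensional, as membership in \<open>solutions_T\<close>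
  demands.\<close>

lemma mersenne_solution_outside: "i \<notin> {1..n + 11} \<Longrightarrow> mersenne_solution p n i = undefined"
  by (auto simp: mersenne_solution_def Let_def)

context
  fixes p n :: nat and y t m w :: int
  assumes p: "p \<le> n" "p > 2 ^ 11" and prime: "prime (2 ^ p - 1 :: int)"
    and mod_5: "(2 ^ p - 1 :: int) mod 5 = 2"
  defines "y \<equiv> 2 ^ p" and "t \<equiv> (y - 3) div 5" and "m \<equiv> y - 1" and "w \<equiv> y ^ 2 ^ p - y"
begin

text \<open>Both divisions in the explicit solution are exact: \<open>y - 3\<close> is divisible by
  5 because of \<open>mod_5\<close>, and \<open>w\<close> by \<open>m * m\<close> because of
  \<open>power_one_plus_dvd\<close>.\<close>

lemma mersenne_parameters:
  shows "y = 5 * t + 3" "t > 0" "m > 0" "w = m * m * (w div (m * m))" "w > 0" "w div (m * m) > 0"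
proof -
  have "(2::int) ^ 3 \<le> y" unfolding y_def using p by (intro power_increasing) auto
  then have "y \<ge> 8" by simp
  have "(y - 1) mod 5 = 2" using mod_5 by (simp add: y_def)
  then show yt: "y = 5 * t + 3" unfolding t_def by presburger
  show "t > 0" using yt \<open>y \<ge> 8\<close> by simp
  show "m > 0" using \<open>y \<ge> 8\<close> by (simp add: m_def)
  have "m * m dvd (1 + m) ^ 2 ^ p - 1 - int (2 ^ p) * m" by (rule power_one_plus_dvd)
  \<comment> \<open>The exponent \<open>2 ^ p\<close> is itself \<open>1 + m\<close>, so the linear
    term contributes \<open>m + m * m\<close>.\<close>
  also have "(1 + m) ^ 2 ^ p - 1 - int (2 ^ p) * m = w - m * m"
    by (simp add: w_def m_def y_def algebra_simps)
  finally have "m * m dvd (w - m * m) + m * m" by (intro dvd_add) simp_all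
  then have "m * m dvd w" by simp
  then show w: "w = m * m * (w div (m * m))" by simp
  have "1 < (2::nat) ^ p" using p by (intro one_less_power) auto
  then have "y ^ 1 < y ^ 2 ^ p" using \<open>y \<ge> 8\<close> by (intro power_strict_increasing) auto
  then show "w > 0" by (simp add: w_def)
  then show "w div (m * m) > 0" using w \<open>m > 0\<close> by (metis zero_less_mult_pos mult_pos_pos)
qed

lemma mersenne_solution_values:
  "i \<in> {1..n + 1} \<Longrightarrow> mersenne_solution p n i = y ^ 2 ^ (i - 1)"
  "mersenne_solution p n (n + 2) = t"
  "mersenne_solution p n (n + 3) = 2 * t"
  "mersenne_solution p n (n + 4) = 4 * t"
  "mersenne_solution p n (n + 5) = 5 * t"
  "mersenne_solution p n (n + 6) = 1"
  "mersenne_solution p n (n + 7) = 5 * t + 1"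
  "mersenne_solution p n (n + 8) = m"
  "mersenne_solution p n (n + 9) = m * m"
  "mersenne_solution p n (n + 10) = w div (m * m)"
  "mersenne_solution p n (n + 11) = w"
  by (auto simp: mersenne_solution_def Let_def y_def t_def m_def w_def)

lemma mersenne_solution_system: "mersenne_system p n (mersenne_solution p n)"
proof -
  have "mersenne_solution p n i * mersenne_solution p n i = mersenne_solution p n (i + 1)"
    if "i \<in> {1..n}" for i
  proof -
    have "y ^ 2 ^ (i - 1) * y ^ 2 ^ (i - 1) = y ^ 2 ^ Suc (i - 1)"
      by (simp add: power_add[symmetric] mult_2[symmetric])
    moreover have "Suc (i - 1) = i" using that by simp
    ultimately show ?thesis
      using that mersenne_solution_values(1)[of i] mersenne_solution_values(1)[of "i + 1"] by simp
  qed
  moreover have "mersenne_solution p n 1 = y" "mersenne_solution p n (p + 1) = y ^ 2 ^ p"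
    using p by (simp_all add: mersenne_solution_values)
  ultimately show ?thesis
    using mersenne_parameters(1) mersenne_parameters(4)[symmetric]
    unfolding mersenne_system_def mersenne_solution_values
    by (simp add: m_def[symmetric]) (simp add: m_def w_def)
qed

lemma mersenne_system_unique:
  assumes sys: "mersenne_system p n x" and i: "i \<in> {1..n + 11}"
  shows "x i = mersenne_solution p n i"
proof -
  have x1: "x 1 = y"
    using mersenne_system_first[OF p(1) prime mod_5 sys] by (simp add: y_def)
  have chain: "x (i + 1) = y ^ 2 ^ i" if "i \<le> n" for i
    using iterated_squares[of n x i] sys that x1 by (simp add: mersenne_system_def)
  have t: "x (n + 2) = t"
    using sys x1 mersenne_parameters(1) by (simp add: mersenne_system_def)
  have m: "x (n + 8) = m"
    using sys x1 by (simp add: mersenne_system_def m_def)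
  have w: "x (n + 11) = w"
    using sys x1 chain[OF p(1)] by (simp add: mersenne_system_def w_def)
  have "m * m * x (n + 10) = m * m * (w div (m * m))"
    using sys m w mersenne_parameters(4) by (simp add: mersenne_system_def)
  \<comment> \<open>The equation fixes \<open>x (n + 10)\<close> because \<open>m\<close> is
    nonzero.\<close>
  then have z: "x (n + 10) = w div (m * m)"
    using mersenne_parameters(3) by simp
  have "x i = mersenne_solution p n i" if "i \<in> {1..n + 1}"
  proof -
    have "i - 1 \<le> n" "i - 1 + 1 = i" using that by auto
    then show ?thesis using chain[of "i - 1"] mersenne_solution_values(1)[OF that] by metis
  qed
  moreover have "x (n + 3) = 2 * t" "x (n + 4) = 4 * t" "x (n + 5) = 5 * t" "x (n + 6) = 1"
    "x (n + 7) = 5 * t + 1" "x (n + 9) = m * m"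
    using sys t m by (simp_all add: mersenne_system_def)
  ultimately show ?thesis
    using i t m w z unfolding atLeastAtMost_add_11 
    by (auto simp: mersenne_solution_values simp del: add_2_eq_Suc')
qed

lemma mersenne_solution_pos: "i \<in> {1..n + 11} \<Longrightarrow> mersenne_solution p n i > 0"
  unfolding atLeastAtMost_add_11 using mersenne_parameters
  by (auto simp: mersenne_solution_values y_def simp del: add_2_eq_Suc')

lemma mersenne_solution_large: "mersenne_solution p n (n + 1) > 2 ^ 2 ^ (n + 11)"
proof -
  \<comment> \<open>Here \<open>p > 2 ^ 11\<close> yields the bound, through the last iterated
    square \<open>2 ^ (p * 2 ^ n)\<close>.\<close>
  have "(2::nat) ^ (n + 11) < p * 2 ^ n" using p by (simp add: power_add mult.commute)
  then have "(2::int) ^ 2 ^ (n + 11) < 2 ^ (p * 2 ^ n)" by (intro power_strict_increasing) auto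
  also have "\<dots> = mersenne_solution p n (n + 1)"
    by (simp add: mersenne_solution_values y_def power_mult)
  finally show ?thesis .
qed

end

section \<open>The case \<open>p = 2203\<close>\<close>

lemma system_T_iff: "system_T n x \<longleftrightarrow> mersenne_system 2203 n x"
proof -
  have "(2203::nat) + 1 = 2204" by simp
  then show ?thesis by (simp only: system_T_def mersenne_system_def)
qed

lemma prime_mersenne_2203_int: "prime (2 ^ 2203 - 1 :: int)"
proof -
  have "int (2 ^ k - 1) = 2 ^ k - 1" for k
    by (simp add: of_nat_diff)
  then show ?thesis
    using prime_mersenne_2203 prime_nat_int_transfer[of "2 ^ 2203 - 1"] by metis
qed

text \<open>Powers of 2 have period 4 modulo 5, and 2203 is 3 modulo 4.\<close>

lemma mersenne_2203_mod_5: "(2 ^ 2203 - 1 :: int) mod 5 = 2"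
proof -
  have "(2 ^ (4 * k + 3) - 1 :: int) mod 5 = 2" for k
  proof (induction k)
    case (Suc k)
    have "(2 ^ (4 * Suc k + 3) - 1 :: int) = 16 * (2 ^ (4 * k + 3) - 1) + 15"
      by (simp add: power_add)
    then show ?case using Suc by presburger
  qed simp
  moreover have "(2203::nat) = 4 * 550 + 3" by simp
  ultimately show ?thesis by metis
qed

theorem theorem1:
  fixes n :: nat
  assumes "n \<ge> 2203"
  shows "(\<exists>!a. a \<in> solutions_T n) \<and>
         (\<forall>a\<in>solutions_T n.
            (\<forall>i\<in>{1..n + 11}. a i > 0) \<and>
            Max (a ` {1..n + 11}) > 2 ^ (2 ^ (n + 11)))"
proof -
  have p: "(2203::nat) > 2 ^ 11" by simp
  note hyps = assms p prime_mersenne_2203_int mersenne_2203_mod_5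
  define s where "s = mersenne_solution 2203 n"
  have outside: "s i = undefined" if "i \<notin> {1..n + 11}" for i
    using mersenne_solution_outside[OF that] by (simp only: s_def)
  have iff: "a \<in> solutions_T n \<longleftrightarrow> a = s" for a
  proof
    assume a: "a \<in> solutions_T n"
    then have "mersenne_system 2203 n a" by (simp only: solutions_T_def mem_Collect_eq system_T_iff)
    then have "a i = s i" if "i \<in> {1..n + 11}" for i
      using mersenne_system_unique[OF hyps] that by (simp only: s_def)
    \<comment> \<open>Outside the index set both functions are \<open>undefined\<close>, so
      agreement on the indices gives equality of functions.\<close>
    moreover have "a i = s i" if "i \<notin> {1..n + 11}" for i
      using a that outside by (auto simp: solutions_T_def PiE_def extensional_def)
    ultimately show "a = s" by blast
  next
    assume "a = s"
    moreover have "s \<in> {1..n + 11} \<rightarrow>\<^sub>E UNIV"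
      using outside by (simp add: PiE_def extensional_def)
    moreover have "system_T n s"
      unfolding system_T_iff s_def by (rule mersenne_solution_system[OF hyps])
    ultimately show "a \<in> solutions_T n"
      by (simp only: solutions_T_def mem_Collect_eq simp_thms)
  qed
  have pos: "\<forall>i\<in>{1..n + 11}. s i > 0"
    unfolding s_def using mersenne_solution_pos[OF hyps] by blast
  have "2 ^ 2 ^ (n + 11) < s (n + 1)"
    unfolding s_def by (rule mersenne_solution_large[OF hyps])
  also have "s (n + 1) \<le> Max (s ` {1..n + 11})"
    by (rule Max_ge) auto
  finally have "2 ^ 2 ^ (n + 11) < Max (s ` {1..n + 11})" .
  moreover have "solutions_T n = {s}" using iff by blast
  ultimately show ?thesis using pos by simp
qed

end
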